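(* Let $A$ be a finite alphabet and let $\mu=(\mu_n)_{n\ge 0}$ be a sequence of Bernoulli measures on $A^{\mathbb Z}$ which converges (in the weak-$*$ topology) to a positive Bernoulli measure $\overline{\mu}$ on $A^{\mathbb Z}$. Then for every rational language $L\subset A^*$, the sequential density of $L$ with respect to $\mu$ exists and equals the density of $L$ with respect to $\overline{\mu}$, that is, $$\lim_{n\to\infty}\frac1n\sum_{i=0}^{n-1}\mu_i(L\cap A^i)=\lim_{n\to\infty}\frac1n\sum_{i=0}^{n-1}\overline{\mu}(L\cap A^i),$$ both limits existing. Moreover, if $L$ is aperiodic, the same holds for densities in the strong sense, that is, $$\lim_{n\to\infty}\mu_n(L\cap A^n)=\lim_{n\to\infty}\overline{\mu}(L\cap A^n),$$ both limits existing.
   Context: $A^*$ is the set of all finite words over the finite alphabet $A$ (including the empty word), and $A^n$ the set of words of length $n$. $A^{\mathbb Z}$ carries the product topology of discrete topologies and its Borel $\sigma$-algebra. For a word $w$, $[w]=\{x\in A^{\mathbb Z}\mid x_0\cdots x_{|w|-1}=w\}$. For a probability measure $\nu$ on $A^{\mathbb Z}$, write $\nu(w)=\nu([w])$ for a word $w$, and $\nu(W)=\sum_{w\in W}\nu(w)$ for a set of words $W\subset A^*$. A Bernoulli measure is a probability measure $\nu$ on $A^{\mathbb Z}$ such that $\nu(uv)=\nu(u)\nu(v)$ for all $u,v\in A^*$. It is positive if $\nu(a)>0$ for every letter $a\in A$. Weak-$*$ convergence $\mu_n\to\overline\mu$ means $\int f\,d\mu_n\to\int f\,d\overline\mu$ for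 every continuous $f\colon A^{\mathbb Z}\to\mathbb R$ (equivalently, $\mu_n(U)\to\overline\mu(U)$ for every clopen $U$). A language is a subset of $A^*$. A language is rational if it is recognized by a finite automaton: there are a finite set $Q$, a map $Q\times A\to Q$, $(q,a)\mapsto q\cdot a$ (extended to a right action of words), $i\in Q$ and $T\subset Q$ with $L=\{w\in A^*\mid i\cdot w\in T\}$. Equivalently, $L=\varphi^{-1}(N)$ for some monoid morphism $\varphi\colon A^*\to M$ to a finite monoid and some $N\subset M$ (one says $L$ is recognized by $\varphi$). A finite monoid $M$ is aperiodic if there is $n\ge1$ with $m^n=m^{n+1}$ for all $m\in M$. A rational language is aperiodic if it is recognized by a morphism into a finite aperiodic monoid. The sequential density of $L$ with respect to a sequence $\mu=(\mu_n)_{n\ge0}$ of probability measures on $A^{\mathbb Z}$ is $\delta_\mu(L)=\lim_{n\to\infty}\frac1n\sum_{i=0}^{n-1}\mu_i(L\cap A^i)$ whenever the limit exists; it exists in the strong sense if $\lim_{n\to\infty}\mu_n(L\cap A^n)$ exists. The density with respect to a single measure $\overline\mu$ is the sequential density with respect to the constant sequence $\overline\mu$. *)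

theory Defs
  imports "HOL-Probability.Probability" "HOL-Algebra.Group"
begin

text \<open>The finite alphabet is a type \<open>'a\<close> of class \<open>finite\<close>; words are lists,
  bi-infinite sequences are functions \<open>int \<Rightarrow> 'a\<close>.\<close>

section \<open>Measures on the full shift\<close>

definition full_shift :: "(int \<Rightarrow> 'a) topology" where
  "full_shift = product_topology (\<lambda>_. discrete_topology UNIV) UNIV"

definition shift_borel :: "(int \<Rightarrow> 'a) measure" where
  "shift_borel = sigma UNIV {U. openin full_shift U}"

definition cylinder :: "'a list \<Rightarrow> (int \<Rightarrow> 'a) set" where
  "cylinder w = {x. \<forall>k<length w. x (int k) = w ! k}"

definition words :: "nat \<Rightarrow> 'a list set" where
  "words n = {w. length w = n}"

text \<open>Only applied to sets of words of a fixed length, which are finite.\<close>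

definition words_measure :: "(int \<Rightarrow> 'a) measure \<Rightarrow> 'a list set \<Rightarrow> real" where
  "words_measure \<nu> W = (\<Sum>w\<in>W. measure \<nu> (cylinder w))"

text \<open>Shift invariance is not assumed: the multiplicativity condition only constrains
  the distribution of the coordinates with nonnegative index.\<close>

definition bernoulli_measure :: "(int \<Rightarrow> 'a) measure \<Rightarrow> bool" where
  "bernoulli_measure \<nu> \<longleftrightarrow>
     prob_space \<nu> \<and> sets \<nu> = sets shift_borel \<and>
     (\<forall>u v. measure \<nu> (cylinder (u @ v)) = measure \<nu> (cylinder u) * measure \<nu> (cylinder v))"

definition positive_measure :: "(int \<Rightarrow> 'a) measure \<Rightarrow> bool" where
  "positive_measure \<nu> \<longleftrightarrow> (\<forall>a. measure \<nu> (cylinder [a]) > 0)"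

definition weak_star_tendsto ::
    "(nat \<Rightarrow> (int \<Rightarrow> 'a) measure) \<Rightarrow> (int \<Rightarrow> 'a) measure \<Rightarrow> bool" where
  "weak_star_tendsto \<mu> \<nu> \<longleftrightarrow>
     (\<forall>f. continuous_map full_shift euclideanreal f \<longrightarrow>
        (\<lambda>n. \<integral>x. f x \<partial>\<mu> n) \<longlonglongrightarrow> (\<integral>x. f x \<partial>\<nu>))"

section \<open>Rational and aperiodic languages\<close>

definition recognized_by_automaton ::
    "'q set \<Rightarrow> ('q \<Rightarrow> 'a \<Rightarrow> 'q) \<Rightarrow> 'q \<Rightarrow> 'q set \<Rightarrow> 'a list set \<Rightarrow> bool" where
  "recognized_by_automaton Q \<delta> i T L \<longleftrightarrow>
     finite Q \<and> (\<forall>q\<in>Q. \<forall>a. \<delta> q a \<in> Q) \<and> i \<in> Q \<and> T \<subseteq> Q \<and> L = {w. foldl \<delta> i w \<in> T}"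

text \<open>HOL cannot quantify existentially over the type of states. States are therefore
  taken in \<open>nat\<close>, which loses nothing: see \<open>rational_languageI\<close> below. The
  same applies to the carrier of the monoid in \<open>aperiodic_language\<close>.\<close>

definition rational_language :: "'a list set \<Rightarrow> bool" where
  "rational_language L \<longleftrightarrow>
     (\<exists>(Q :: nat set) \<delta> i T. recognized_by_automaton Q \<delta> i T L)"

definition word_monoid :: "'a list monoid" where
  "word_monoid = \<lparr>carrier = UNIV, mult = (@), one = []\<rparr>"

text \<open>\<open>hom\<close> does not require preservation of the unit.\<close>

definition monoid_morphism :: "('a list \<Rightarrow> 'm) \<Rightarrow> 'm monoid \<Rightarrow> bool" where
  "monoid_morphism \<phi> M \<longleftrightarrow> \<phi> \<in> hom word_monoid M \<and> \<phi> [] = \<one>\<^bsub>M\<^esub>"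

definition aperiodic_monoid :: "'m monoid \<Rightarrow> bool" where
  "aperiodic_monoid M \<longleftrightarrow>
     (\<exists>n::nat. n \<ge> 1 \<and> (\<forall>m\<in>carrier M. m [^]\<^bsub>M\<^esub> n = m [^]\<^bsub>M\<^esub> (n + 1)))"

definition aperiodic_language :: "'a list set \<Rightarrow> bool" where
  "aperiodic_language L \<longleftrightarrow>
     rational_language L \<and>
     (\<exists>(M :: nat monoid) \<phi> N.
        monoid M \<and> finite (carrier M) \<and> aperiodic_monoid M \<and>
        monoid_morphism \<phi> M \<and> N \<subseteq> carrier M \<and> L = \<phi> -` N)"

lemma rational_languageI:
  fixes Q :: "'q set"
  assumes "recognized_by_automaton Q \<delta> i T L"
  shows "rational_language L"
proof -
  from assms have fin: "finite Q" and cl: "\<And>q a. q \<in> Q \<Longrightarrow> \<delta> q a \<in> Q" and i: "i \<in> Q"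
    and T: "T \<subseteq> Q" and L: "L = {w. foldl \<delta> i w \<in> T}"
    by (auto simp: recognized_by_automaton_def)
  obtain f :: "'q \<Rightarrow> nat" where f: "inj_on f Q"
    using finite_imp_inj_to_nat_seg[OF fin] by blast
  define \<delta>' where "\<delta>' = (\<lambda>k a. f (\<delta> (inv_into Q f k) a))"
  have run: "q \<in> Q \<Longrightarrow> foldl \<delta> q w \<in> Q \<and> foldl \<delta>' (f q) w = f (foldl \<delta> q w)" for q w
    by (induction w arbitrary: q) (auto simp: \<delta>'_def f cl)
  have "L = {w. foldl \<delta>' (f i) w \<in> f ` T}"
    using run[OF i] T inj_on_image_mem_iff[OF f] by (auto simp: L)
  then have "recognized_by_automaton (f ` Q) \<delta>' (f i) (f ` T) L"
    using fin i T cl by (auto simp: recognized_by_automaton_def \<delta>'_def f)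
  then show ?thesis
    unfolding rational_language_def by blast
qed

lemma aperiodic_languageI:
  fixes M :: "'m monoid"
  assumes rat: "rational_language L" and M: "monoid M" and fin: "finite (carrier M)"
    and ap: "aperiodic_monoid M" and mor: "monoid_morphism \<phi> M"
    and N: "N \<subseteq> carrier M" and L: "L = \<phi> -` N"
  shows "aperiodic_language L"
proof -
  interpret monoid M by (fact M)
  obtain f :: "'m \<Rightarrow> nat" where f: "inj_on f (carrier M)"
    using finite_imp_inj_to_nat_seg[OF fin] by blast
  define g where "g = inv_into (carrier M) f"
  have g [simp]: "g (f x) = x" if "x \<in> carrier M" for x
    using f that by (simp add: g_def)
  define M' where "M' = \<lparr>carrier = f ` carrier M,
      mult = (\<lambda>x y. f (g x \<otimes>\<^bsub>M\<^esub> g y)), one = f \<one>\<^bsub>M\<^esub>\<rparr>"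
  have M': "monoid M'"
    by (rule monoidI) (auto simp: M'_def m_assoc)
  have pow: "f m [^]\<^bsub>M'\<^esub> k = f (m [^]\<^bsub>M\<^esub> k)" if "m \<in> carrier M" for m and k :: nat
  proof (induction k)
    case 0
    show ?case
      using monoid.nat_pow_0[OF M'] by (simp add: M'_def)
  next
    case (Suc k)
    have "f m [^]\<^bsub>M'\<^esub> Suc k = (f m [^]\<^bsub>M'\<^esub> k) \<otimes>\<^bsub>M'\<^esub> f m"
      using monoid.nat_pow_Suc[OF M'] by simp
    also have "\<dots> = f (m [^]\<^bsub>M\<^esub> k) \<otimes>\<^bsub>M'\<^esub> f m"
      by (simp only: Suc.IH)
    also have "\<dots> = f (m [^]\<^bsub>M\<^esub> Suc k)"
      using that by (simp add: M'_def)
    finally show ?case .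
  qed
  obtain n :: nat where "n \<ge> 1"
    and "\<And>m. m \<in> carrier M \<Longrightarrow> m [^]\<^bsub>M\<^esub> n = m [^]\<^bsub>M\<^esub> (n + 1)"
    using ap unfolding aperiodic_monoid_def by blast
  moreover have "carrier M' = f ` carrier M" by (simp add: M'_def)
  ultimately have "m [^]\<^bsub>M'\<^esub> n = m [^]\<^bsub>M'\<^esub> (n + 1)" if "m \<in> carrier M'" for m
    using that pow by (metis imageE)
  with \<open>n \<ge> 1\<close> have ap': "aperiodic_monoid M'"
    unfolding aperiodic_monoid_def by blast
  have closed: "\<phi> w \<in> carrier M" for w
    using mor by (auto simp: monoid_morphism_def hom_def word_monoid_def)
  have mor': "monoid_morphism (f \<circ> \<phi>) M'"
    using mor closed by (auto simp: monoid_morphism_def hom_def word_monoid_def M'_def)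
  have "L = (f \<circ> \<phi>) -` (f ` N)"
    using inj_on_image_mem_iff[OF f closed N] by (simp add: L vimage_def)
  moreover have "f ` N \<subseteq> carrier M'" "finite (carrier M')"
    using N fin by (auto simp: M'_def)
  ultimately show ?thesis
    unfolding aperiodic_language_def using rat M' ap' mor' by blast
qed

section \<open>Densities\<close>

definition has_sequential_density ::
    "(nat \<Rightarrow> (int \<Rightarrow> 'a) measure) \<Rightarrow> 'a list set \<Rightarrow> real \<Rightarrow> bool" where
  "has_sequential_density \<mu> L d \<longleftrightarrow>
     (\<lambda>n. (1 / real n) * (\<Sum>i<n. words_measure (\<mu> i) (L \<inter> words i))) \<longlonglongrightarrow> d"

definition has_strong_sequential_density ::
    "(nat \<Rightarrow> (int \<Rightarrow> 'a) measure) \<Rightarrow> 'a list set \<Rightarrow> real \<Rightarrow> bool" where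
  "has_strong_sequential_density \<mu> L d \<longleftrightarrow>
     (\<lambda>n. words_measure (\<mu> n) (L \<inter> words n)) \<longlonglongrightarrow> d"

definition has_density :: "(int \<Rightarrow> 'a) measure \<Rightarrow> 'a list set \<Rightarrow> real \<Rightarrow> bool" where
  "has_density \<nu> L d \<longleftrightarrow> has_sequential_density (\<lambda>_. \<nu>) L d"

definition has_strong_density :: "(int \<Rightarrow> 'a) measure \<Rightarrow> 'a list set \<Rightarrow> real \<Rightarrow> bool" where
  "has_strong_density \<nu> L d \<longleftrightarrow> has_strong_sequential_density (\<lambda>_. \<nu>) L d"

end

theory Submission
  imports Defs
begin

text \<open>
  A Bernoulli measure sees words only through its letter probabilities: with
  \<open>p a = \<nu> [a]\<close>, the measure of a word is the product \<open>p w\<close> of the probabilities of its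
  letters. If an automaton recognizes \<open>L\<close> from the state \<open>i\<close> with terminal states \<open>T\<close>, then
  \<open>\<nu> (L \<inter> A\<^sup>n)\<close> is the probability that the Markov chain on the states, which reads random
  letters with distribution \<open>p\<close>, is in \<open>T\<close> at time \<open>n\<close>. So the theorem compares, at time
  \<open>n\<close>, the chain with letter distribution \<open>p\<^sub>n\<close> to the chain with the limit distribution
  \<open>p\<close>. For a fixed time \<open>k\<close> the comparison is trivial, since the probability of being in
  \<open>T\<close> at time \<open>k\<close> is a polynomial in \<open>p\<close>. The difficulty is that the time grows together
  with the index.

  The remedy is that the chains forget their past at a rate that depends only on a lower bound
  \<open>c > 0\<close> for the letter probabilities, and positivity of \<open>p\<close> gives such a bound for
  \<open>p\<close> and for almost all \<open>p\<^sub>n\<close> at once. More precisely, for a suitable period \<open>e\<close> the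
  chain at time \<open>k\<close> and the chain at time \<open>l\<close> differ by an exponentially small amount as
  soon as \<open>k\<close> and \<open>l\<close> are large and congruent modulo \<open>e\<close>
  (\<open>expectation_after_eventually_periodic\<close>). Hence time \<open>n\<close> may be replaced by a bounded
  time congruent to \<open>n\<close>, where the limit \<open>p\<^sub>n \<rightarrow> p\<close> can be taken, and the two
  chains have the same asymptotically \<open>e\<close>-periodic behaviour (\<open>expectation_after_perturbation\<close>).
  The means of an asymptotically periodic sequence converge, which gives the densities; if
  \<open>e = 1\<close>, the sequence itself converges, which gives the densities in the strong sense.

  It remains to find \<open>e\<close>. This is a statement on the automaton alone, without
  probabilities. What makes the chain mix is that from every state some word leads into a
  class of states, closed under words of length \<open>e\<close>, all of whose members can be sent to one
  state by words of a common length \<open>D\<close>. Choosing \<open>D\<close> such that reachability by words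
  of length \<open>D\<close> is an idempotent relation, one can take minimal sets of reachable states as
  classes, with \<open>e = D\<close> (\<open>finite_automaton_mixing\<close>). If a letter \<open>a\<close> satisfies
  \<open>q a\<^sup>n = q a\<^sup>n\<^sup>+\<^sup>1\<close> for all states \<open>q\<close>, as every letter does in the Cayley graph of an
  aperiodic monoid, then each class contains a state fixed by \<open>a\<close>, and waiting in this state
  removes the periodicity, so that \<open>e = 1\<close> (\<open>aperiodic_automaton_mixing\<close>).
\<close>

section \<open>Averages over words of a fixed length\<close>

definition word_weight :: "('a \<Rightarrow> real) \<Rightarrow> 'a list \<Rightarrow> real" where
  "word_weight p w = prod_list (map p w)"

text \<open>The \<open>k\<close>-th power of the transition operator of the chain, written as a sum over words
  rather than over paths of states: this keeps the words available by which classes are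
  synchronized, and makes sense for an arbitrary set of states.\<close>

definition expectation_after ::
    "('a \<Rightarrow> real) \<Rightarrow> ('q \<Rightarrow> 'a \<Rightarrow> 'q) \<Rightarrow> nat \<Rightarrow> ('q \<Rightarrow> real) \<Rightarrow> 'q \<Rightarrow> real" where
  "expectation_after p \<delta> k f q = (\<Sum>w\<in>words k. word_weight p w * f (foldl \<delta> q w))"

lemma word_weight_append: "word_weight p (u @ v) = word_weight p u * word_weight p v"
  by (simp add: word_weight_def)

lemma finite_words [simp]: "finite (words n :: 'a::finite list set)"
  using finite_lists_length_eq[of "UNIV :: 'a set" n] by (simp add: words_def)

lemma words_0: "words 0 = {[]}"
  by (auto simp: words_def)

lemma append_in_words: "u \<in> words j \<Longrightarrow> v \<in> words k \<Longrightarrow> u @ v \<in> words (j + k)"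
  by (simp add: words_def)

lemma words_addE:
  assumes "w \<in> words (j + k)"
  obtains u v where "u \<in> words j" "v \<in> words k" "w = u @ v"
  using that[of "take j w" "drop j w"] assms by (simp add: words_def)

lemma sum_words_add:
  fixes h :: "'a::finite list \<Rightarrow> real"
  shows "(\<Sum>w\<in>words (j + k). h w) = (\<Sum>u\<in>words j. \<Sum>v\<in>words k. h (u @ v))"
proof -
  have "bij_betw (\<lambda>(u, v). u @ v) (words j \<times> words k) (words (j + k) :: 'a list set)"
    unfolding bij_betw_def
  proof
    show "inj_on (\<lambda>(u, v). u @ v) (words j \<times> words k :: ('a list \<times> 'a list) set)"
      by (auto simp: inj_on_def words_def)
    show "(\<lambda>(u, v). u @ v) ` (words j \<times> words k) = (words (j + k) :: 'a list set)"
      by (auto simp: append_in_words elim!: words_addE)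
  qed
  from sum.reindex_bij_betw[OF this, of h]
  show ?thesis by (simp add: sum.cartesian_product case_prod_unfold)
qed

lemma sum_words_1: "(\<Sum>w\<in>words 1. h w) = (\<Sum>a\<in>UNIV. h [a])"
  for h :: "'a::finite list \<Rightarrow> real"
proof -
  have "words 1 = range (\<lambda>a :: 'a. [a])"
    by (auto simp: words_def length_Suc_conv)
  then show ?thesis
    by (simp add: sum.reindex inj_on_def)
qed

text \<open>The semigroup property of the transition operator.\<close>

lemma expectation_after_add:
  fixes p :: "'a::finite \<Rightarrow> real"
  shows "expectation_after p \<delta> (j + k) f q
    = expectation_after p \<delta> j (expectation_after p \<delta> k f) q"
  by (simp add: expectation_after_def sum_words_add word_weight_append sum_distrib_left mult.assoc)

lemma expectation_after_diff:
  fixes p :: "'a::finite \<Rightarrow> real"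
  shows "expectation_after p \<delta> k (\<lambda>q. f q - g q) q
    = expectation_after p \<delta> k f q - expectation_after p \<delta> k g q"
  by (simp add: expectation_after_def right_diff_distrib sum_subtractf)

lemma expectation_after_tendsto:
  fixes p :: "'a::finite \<Rightarrow> real"
  assumes "\<And>a. ((\<lambda>n. P n a) \<longlongrightarrow> p a) F"
  shows "((\<lambda>n. expectation_after (P n) \<delta> k f q) \<longlongrightarrow> expectation_after p \<delta> k f q) F"
proof -
  have "((\<lambda>n. word_weight (P n) w) \<longlongrightarrow> word_weight p w) F" for w
    unfolding word_weight_def by (induction w) (auto intro!: tendsto_mult assms)
  then show ?thesis
    unfolding expectation_after_def by (intro tendsto_sum tendsto_mult tendsto_const)
qed

text \<open>The source of every contraction below: a single index of weight at least \<open>\<eta>\<close> at which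
  \<open>h\<close> has the smaller bound \<open>K0\<close> pulls the trivial bound \<open>K\<close> towards \<open>K0\<close> by the factor
  \<open>\<eta>\<close>.\<close>

lemma abs_weighted_sum_le_improved:
  fixes m h :: "'i \<Rightarrow> real"
  assumes fin: "finite I" and m: "\<And>i. i \<in> I \<Longrightarrow> 0 \<le> m i" "sum m I = 1"
    and h: "\<And>i. i \<in> I \<Longrightarrow> \<bar>h i\<bar> \<le> K"
    and i0: "i0 \<in> I" "\<bar>h i0\<bar> \<le> K0" "K0 \<le> K" "\<eta> \<le> m i0"
  shows "\<bar>\<Sum>i\<in>I. m i * h i\<bar> \<le> \<eta> * K0 + (1 - \<eta>) * K"
proof -
  have "\<bar>\<Sum>i\<in>I. m i * h i\<bar> \<le> (\<Sum>i\<in>I. m i * \<bar>h i\<bar>)"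
    using sum_abs[of "\<lambda>i. m i * h i" I] m by (simp add: abs_mult)
  also have "\<dots> = m i0 * \<bar>h i0\<bar> + (\<Sum>i\<in>I - {i0}. m i * \<bar>h i\<bar>)"
    by (rule sum.remove[OF fin i0(1)])
  also have "\<dots> \<le> m i0 * K0 + (\<Sum>i\<in>I - {i0}. m i * K)"
    using i0 m h by (intro add_mono sum_mono mult_left_mono) auto
  also have "(\<Sum>i\<in>I - {i0}. m i * K) = (1 - m i0) * K"
    using sum.remove[OF fin i0(1), of m] m(2) by (simp flip: sum_distrib_right)
  also have "m i0 * K0 + (1 - m i0) * K = K - m i0 * (K - K0)"
    by (simp add: algebra_simps)
  also have "\<dots> \<le> K - \<eta> * (K - K0)"
    using i0 by (intro diff_left_mono mult_right_mono) auto
  finally show ?thesis by (simp add: algebra_simps)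
qed

locale letter_distribution =
  fixes p :: "'a::finite \<Rightarrow> real"
  assumes nonneg: "0 \<le> p a" and sum_1: "sum p UNIV = 1"
begin

lemma word_weight_nonneg: "0 \<le> word_weight p w"
  unfolding word_weight_def by (induction w) (auto simp: nonneg)

lemma sum_word_weight: "(\<Sum>w\<in>words k. word_weight p w) = 1"
proof (induction k)
  case 0
  show ?case by (simp add: words_0 word_weight_def)
next
  case (Suc k)
  have "(\<Sum>w\<in>words (Suc k). word_weight p w)
      = (\<Sum>u\<in>words 1. word_weight p u * (\<Sum>v\<in>words k. word_weight p v))"
    using sum_words_add[of "word_weight p" 1 k] by (simp add: word_weight_append sum_distrib_left)
  also have "\<dots> = 1"
    unfolding Suc.IH sum_words_1 using sum_1 by (simp add: word_weight_def)
  finally show ?case .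
qed

lemma word_weight_ge:
  assumes "\<And>a. c \<le> p a" "0 \<le> c" "w \<in> words k"
  shows "c ^ k \<le> word_weight p w"
  using assms(3)
proof (induction k arbitrary: w)
  case 0
  then show ?case by (simp add: words_0 word_weight_def)
next
  case (Suc k)
  then obtain a v where w: "w = a # v" "v \<in> words k"
    by (auto simp: words_def length_Suc_conv)
  have "c * c ^ k \<le> p a * word_weight p v"
    using Suc.IH[OF w(2)] assms(1,2) by (intro mult_mono nonneg) auto
  then show ?case by (simp add: w word_weight_def)
qed

lemma abs_expectation_after_le_improved:
  assumes "\<And>w. w \<in> words k \<Longrightarrow> \<bar>f (foldl \<delta> q w)\<bar> \<le> K"
    and "w0 \<in> words k" "\<bar>f (foldl \<delta> q w0)\<bar> \<le> K0" "K0 \<le> K" "\<eta> \<le> word_weight p w0"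
  shows "\<bar>expectation_after p \<delta> k f q\<bar> \<le> \<eta> * K0 + (1 - \<eta>) * K"
  unfolding expectation_after_def using assms
  by (intro abs_weighted_sum_le_improved[where h = "\<lambda>w. f (foldl \<delta> q w)"])
    (auto simp: word_weight_nonneg sum_word_weight)

lemma abs_expectation_after_le:
  assumes "\<And>w. w \<in> words k \<Longrightarrow> \<bar>f (foldl \<delta> q w)\<bar> \<le> K"
  shows "\<bar>expectation_after p \<delta> k f q\<bar> \<le> K"
proof -
  have "replicate k undefined \<in> words k" by (simp add: words_def)
  from abs_expectation_after_le_improved[of k f \<delta> q K, OF assms this assms[OF this] order_refl
      word_weight_nonneg[of "replicate k undefined"]]
  show ?thesis by (simp add: algebra_simps)
qed

lemma expectation_after_const: "expectation_after p \<delta> k (\<lambda>_. x) q = x"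
  by (simp add: expectation_after_def sum_word_weight flip: sum_distrib_right)

lemma expectation_after_diff_const:
  "expectation_after p \<delta> k f q - x = expectation_after p \<delta> k (\<lambda>s. f s - x) q"
  by (simp add: expectation_after_diff expectation_after_const)

text \<open>Two independent copies of the chain run from \<open>q\<close> and \<open>q'\<close>. A pair of words that
  leads both copies to the same state contributes nothing to the difference.\<close>

lemma expectation_after_minus_eq_double_sum:
  "expectation_after p \<delta> k f q - expectation_after p \<delta> k f q'
   = (\<Sum>(w, w')\<in>words k \<times> words k. (word_weight p w * word_weight p w')
        * (f (foldl \<delta> q w) - f (foldl \<delta> q' w')))"
proof -
  have "expectation_after p \<delta> k f q - expectation_after p \<delta> k f q'
     = expectation_after p \<delta> k (\<lambda>s. f s - expectation_after p \<delta> k f q') q"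
    by (rule expectation_after_diff_const)
  also have "\<dots> = expectation_after p \<delta> k (\<lambda>s. expectation_after p \<delta> k (\<lambda>s'. f s - f s') q') q"
    by (simp add: expectation_after_diff expectation_after_const)
  also have "\<dots> = (\<Sum>w\<in>words k. \<Sum>w'\<in>words k. (word_weight p w * word_weight p w')
        * (f (foldl \<delta> q w) - f (foldl \<delta> q' w')))"
    by (simp add: expectation_after_def sum_distrib_left mult.assoc)
  finally show ?thesis by (simp add: sum.cartesian_product)
qed

end

section \<open>Synchronizing classes and geometric mixing\<close>

definition closed_under_words :: "('q \<Rightarrow> 'a \<Rightarrow> 'q) \<Rightarrow> nat \<Rightarrow> 'q set \<Rightarrow> bool" where
  "closed_under_words \<delta> e C \<longleftrightarrow> (\<forall>s\<in>C. \<forall>w\<in>words e. foldl \<delta> s w \<in> C)"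

definition synchronizing_class :: "('q \<Rightarrow> 'a \<Rightarrow> 'q) \<Rightarrow> nat \<Rightarrow> nat \<Rightarrow> 'q set \<Rightarrow> bool" where
  "synchronizing_class \<delta> e D C \<longleftrightarrow>
     closed_under_words \<delta> e C \<and> (\<exists>t. \<forall>s\<in>C. \<exists>v\<in>words D. foldl \<delta> s v = t)"

text \<open>The combinatorial content of geometric mixing with period \<open>e\<close>. Closure
  is asked for words of length \<open>e\<close> because a chain of period \<open>e\<close> moves cyclically between
  several classes and returns to the same one only every \<open>e\<close> steps. Using one length
  \<open>D\<close> for entering a class and for synchronizing it makes both events have probability at
  least \<open>c\<^sup>D\<close> if every letter has probability at least \<open>c\<close>.\<close>

definition mixing_automaton :: "'q set \<Rightarrow> ('q \<Rightarrow> 'a \<Rightarrow> 'q) \<Rightarrow> nat \<Rightarrow> nat \<Rightarrow> bool" where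
  "mixing_automaton Q \<delta> e D \<longleftrightarrow>
     0 < e \<and> e dvd D \<and> closed_under_words \<delta> 1 Q \<and>
     (\<forall>q\<in>Q. \<exists>C\<subseteq>Q. synchronizing_class \<delta> e D C \<and> (\<exists>w\<in>words D. foldl \<delta> q w \<in> C))"

lemma closed_under_words_multiple:
  assumes "closed_under_words \<delta> e C" "e dvd k"
  shows "closed_under_words \<delta> k C"
proof -
  have "closed_under_words \<delta> (j * e) C" for j
  proof (induction j)
    case 0
    show ?case by (simp add: closed_under_words_def words_0)
  next
    case (Suc j)
    show ?case
      using assms(1) Suc.IH unfolding closed_under_words_def mult_Suc
      by (auto elim!: words_addE)
  qed
  then show ?thesis using assms(2) by (metis dvd_def mult.commute)
qed

lemma synchronizing_class_closed:
  "synchronizing_class \<delta> e D C \<Longrightarrow> e dvd k \<Longrightarrow> closed_under_words \<delta> k C"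
  using closed_under_words_multiple unfolding synchronizing_class_def by blast

context letter_distribution
begin

text \<open>Doeblin's argument: in each block of \<open>D\<close> letters, two independent copies of the chain
  in the same class meet with probability at least \<open>(c\<^sup>D)\<^sup>2\<close>.\<close>

lemma oscillation_contracts:
  assumes C: "synchronizing_class \<delta> e D C" "e dvd D"
    and c: "\<And>a. c \<le> p a" "0 \<le> c"
    and f: "\<And>s s'. s \<in> C \<Longrightarrow> s' \<in> C \<Longrightarrow> \<bar>f s - f s'\<bar> \<le> K"
    and s: "s \<in> C" "s' \<in> C"
  shows "\<bar>expectation_after p \<delta> (N * D) f s - expectation_after p \<delta> (N * D) f s'\<bar>
    \<le> (1 - (c ^ D)\<^sup>2) ^ N * K"
  using s
proof (induction N arbitrary: s s')
  case 0
  then show ?case using f by (simp add: expectation_after_def words_0 word_weight_def)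
next
  case (Suc N)
  define g where "g = expectation_after p \<delta> (N * D) f"
  define K' where "K' = (1 - (c ^ D)\<^sup>2) ^ N * K"
  have cl: "closed_under_words \<delta> D C"
    by (rule synchronizing_class_closed[OF C])
  obtain t where t: "\<And>s. s \<in> C \<Longrightarrow> \<exists>v\<in>words D. foldl \<delta> s v = t"
    using C by (auto simp: synchronizing_class_def)
  obtain v v' where v: "v \<in> words D" "foldl \<delta> s v = t" "v' \<in> words D" "foldl \<delta> s' v' = t"
    using t Suc.prems by blast
  have K': "0 \<le> K'"
    using Suc.IH[OF Suc.prems(1) Suc.prems(1)] by (simp add: K'_def)
  have weight: "(c ^ D)\<^sup>2 \<le> word_weight p v * word_weight p v'"
    unfolding power2_eq_square using v c
    by (intro mult_mono word_weight_ge word_weight_nonneg) auto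
  have "\<bar>expectation_after p \<delta> D g s - expectation_after p \<delta> D g s'\<bar>
      = \<bar>\<Sum>i\<in>words D \<times> words D. (word_weight p (fst i) * word_weight p (snd i))
        * (g (foldl \<delta> s (fst i)) - g (foldl \<delta> s' (snd i)))\<bar>"
    by (simp add: expectation_after_minus_eq_double_sum case_prod_unfold)
  also have "\<dots> \<le> (c ^ D)\<^sup>2 * 0 + (1 - (c ^ D)\<^sup>2) * K'"
  proof (rule abs_weighted_sum_le_improved[where ?i0.0 = "(v, v')"])
    show "(\<Sum>i\<in>words D \<times> words D. word_weight p (fst i) * word_weight p (snd i)) = 1"
      using sum_word_weight[of D]
      by (simp add: sum.cartesian_product' sum_word_weight flip: sum_distrib_left)
    show "\<bar>g (foldl \<delta> s (fst i)) - g (foldl \<delta> s' (snd i))\<bar> \<le> K'" if "i \<in> words D \<times> words D" for i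
      unfolding g_def K'_def using that Suc.prems cl
      by (intro Suc.IH) (auto simp: closed_under_words_def)
  qed (use v K' weight in \<open>auto simp: word_weight_nonneg\<close>)
  finally show ?case
    by (simp add: expectation_after_add K'_def g_def[symmetric])
qed

text \<open>Of the \<open>k\<close> steps, the first \<open>N D\<close> serve to enter a class, where the value is nearly
  constant along an arithmetic progression of times because the remaining steps, at least
  \<open>N D\<close> in number, have made the oscillation small. The rate depends on \<open>p\<close> only through the
  lower bound \<open>c\<close>; this uniformity is what makes perturbations of \<open>p\<close> possible.\<close>

lemma expectation_after_eventually_periodic:
  assumes mix: "mixing_automaton Q \<delta> e D"
    and c: "\<And>a. c \<le> p a" "0 \<le> c"
    and f: "\<And>q. q \<in> Q \<Longrightarrow> 0 \<le> f q \<and> f q \<le> 1"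
    and q: "q \<in> Q"
    and k: "2 * N * D \<le> k" and l: "2 * N * D \<le> l" and kl: "k mod e = l mod e"
  shows "\<bar>expectation_after p \<delta> k f q - expectation_after p \<delta> l f q\<bar>
    \<le> 2 * (1 - (c ^ D)\<^sup>2) ^ N"
proof -
  define \<eta> where "\<eta> = c ^ D"
  have \<eta>: "0 \<le> \<eta>" "\<eta> \<le> 1"
  proof -
    have "p undefined \<le> sum p UNIV" by (rule member_le_sum) (auto simp: nonneg)
    then have "c \<le> 1" using c(1)[of undefined] sum_1 by simp
    then show "0 \<le> \<eta>" "\<eta> \<le> 1" using c by (auto simp: \<eta>_def power_le_one)
  qed
  define \<kappa> where "\<kappa> = 1 - \<eta>\<^sup>2"
  have \<kappa>: "0 \<le> \<kappa>" "1 - \<eta> \<le> \<kappa>"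
    using \<eta> by (auto simp: \<kappa>_def power2_eq_square mult_left_le mult_le_one)
  have eD: "e dvd D" and Q1: "closed_under_words \<delta> 1 Q" and
    classes: "\<And>q. q \<in> Q \<Longrightarrow>
      \<exists>C\<subseteq>Q. synchronizing_class \<delta> e D C \<and> (\<exists>w\<in>words D. foldl \<delta> q w \<in> C)"
    using mix by (auto simp: mixing_automaton_def)
  have Qk: "foldl \<delta> r w \<in> Q" if "r \<in> Q" for r w
    using closed_under_words_multiple[OF Q1, of "length w"] that
    by (simp add: closed_under_words_def words_def)
  have unit_diff: "\<bar>expectation_after p \<delta> i f r - expectation_after p \<delta> j f r'\<bar> \<le> 1"
    if "r \<in> Q" "r' \<in> Q" for i j r r'
  proof -
    have "0 \<le> expectation_after p \<delta> i f r \<and> expectation_after p \<delta> i f r \<le> 1" if "r \<in> Q" for i r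
    proof -
      have "\<bar>expectation_after p \<delta> i f r - 1/2\<bar> \<le> 1/2"
        unfolding expectation_after_diff_const
      proof (rule abs_expectation_after_le)
        show "\<bar>f (foldl \<delta> r w) - 1/2\<bar> \<le> 1/2" for w
          using f[OF Qk[OF that, of w]] by linarith
      qed
      then show ?thesis by linarith
    qed
    from this[OF that(1), of i] this[OF that(2), of j] show ?thesis by linarith
  qed
  \<comment> \<open>Inside a class, running the chain for \<open>j - i\<close> more steps averages values that differ from
      one another by at most the oscillation.\<close>
  have on_class: "\<bar>expectation_after p \<delta> i f s - expectation_after p \<delta> j f s\<bar> \<le> \<kappa> ^ N"
    if C: "C \<subseteq> Q" "synchronizing_class \<delta> e D C" and s: "s \<in> C"
      and ij: "N * D \<le> i" "i \<le> j" "i mod e = j mod e" for C s i j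
  proof -
    define h where "h = expectation_after p \<delta> i f"
    have osc: "\<bar>h r - h r'\<bar> \<le> \<kappa> ^ N" if "r \<in> C" "r' \<in> C" for r r'
    proof -
      have "h = expectation_after p \<delta> (N * D) (expectation_after p \<delta> (i - N * D) f)"
        using ij by (auto simp: h_def fun_eq_iff simp flip: expectation_after_add)
      moreover have "\<bar>expectation_after p \<delta> (N * D) (expectation_after p \<delta> (i - N * D) f) r
          - expectation_after p \<delta> (N * D) (expectation_after p \<delta> (i - N * D) f) r'\<bar>
          \<le> (1 - (c ^ D)\<^sup>2) ^ N * 1"
        using C(1) by (intro oscillation_contracts[OF C(2) eD c _ that] unit_diff) auto
      ultimately show ?thesis by (simp add: \<kappa>_def \<eta>_def)
    qed
    have "e dvd j - i"
      using ij by (metis mod_eq_dvd_iff_nat)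
    then have cl: "closed_under_words \<delta> (j - i) C"
      by (rule synchronizing_class_closed[OF C(2)])
    have "expectation_after p \<delta> j f s = expectation_after p \<delta> (j - i) h s"
      using ij by (simp add: h_def flip: expectation_after_add)
    moreover have "\<bar>expectation_after p \<delta> (j - i) h s - h s\<bar> \<le> \<kappa> ^ N"
      unfolding expectation_after_diff_const
      using cl s osc by (intro abs_expectation_after_le) (auto simp: closed_under_words_def)
    ultimately show ?thesis by (simp add: h_def abs_minus_commute)
  qed
  \<comment> \<open>The last \<open>i\<close> and \<open>j\<close> letters are averaged into \<open>g\<close>, which is small on the classes and
      at most \<open>1\<close> everywhere. The first \<open>N D\<close> letters carry this smallness to all states.\<close>
  define i where "i = k - N * D"
  define j where "j = l - N * D"
  define g where "g = (\<lambda>q. expectation_after p \<delta> i f q - expectation_after p \<delta> j f q)"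
  have ij: "N * D \<le> i" "N * D \<le> j" "i mod e = j mod e"
  proof -
    show *: "N * D \<le> i" "N * D \<le> j"
      using k l by (auto simp: i_def j_def)
    have "e dvd N * D" using eD by simp
    moreover have "k = i + N * D" "l = j + N * D"
      using k l by (auto simp: i_def j_def)
    ultimately show "i mod e = j mod e"
      using kl by (metis add.right_neutral mod_add_right_eq dvd_imp_mod_0)
  qed
  have g_class: "\<bar>g s\<bar> \<le> \<kappa> ^ N"
    if "C \<subseteq> Q" "synchronizing_class \<delta> e D C" "s \<in> C" for C s
  proof (cases "i \<le> j")
    case True
    then show ?thesis using on_class[OF that ij(1) True ij(3)] by (simp add: g_def)
  next
    case False
    then show ?thesis using on_class[OF that ij(2) _ ij(3)[symmetric]]
      by (simp add: g_def abs_minus_commute)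
  qed
  have "\<bar>expectation_after p \<delta> (n * D) g r\<bar> \<le> \<kappa> ^ N + \<kappa> ^ n" if "r \<in> Q" for n r
    using that
  proof (induction n arbitrary: r)
    case 0
    have "\<bar>g r\<bar> \<le> 1" unfolding g_def using 0 by (intro unit_diff)
    moreover have "0 \<le> \<kappa> ^ N" using \<kappa> by simp
    ultimately show ?case
      by (simp add: expectation_after_def words_0 word_weight_def)
  next
    case (Suc n)
    obtain C w where C: "C \<subseteq> Q" "synchronizing_class \<delta> e D C"
      and w: "w \<in> words D" "foldl \<delta> r w \<in> C"
      using classes[OF Suc.prems] by blast
    have cl: "closed_under_words \<delta> (n * D) C"
      by (rule synchronizing_class_closed[OF C(2) dvd_mult[OF eD]])
    have "\<bar>expectation_after p \<delta> D (expectation_after p \<delta> (n * D) g) r\<bar>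
        \<le> \<eta> * \<kappa> ^ N + (1 - \<eta>) * (\<kappa> ^ N + \<kappa> ^ n)"
    proof (rule abs_expectation_after_le_improved)
      show "\<bar>expectation_after p \<delta> (n * D) g (foldl \<delta> r w)\<bar> \<le> \<kappa> ^ N"
        using cl w(2) g_class[OF C]
        by (intro abs_expectation_after_le) (auto simp: closed_under_words_def)
      show "\<kappa> ^ N \<le> \<kappa> ^ N + \<kappa> ^ n" using \<kappa> by simp
      show "\<eta> \<le> word_weight p w" using word_weight_ge c w by (simp add: \<eta>_def)
    qed (use w Suc Qk in auto)
    also have "\<dots> = \<kappa> ^ N + (1 - \<eta>) * \<kappa> ^ n"
      by (simp add: algebra_simps)
    also have "\<dots> \<le> \<kappa> ^ N + \<kappa> ^ Suc n"
      using \<kappa> by (simp add: mult_right_mono)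
    finally show ?case by (simp add: expectation_after_add)
  qed
  from this[OF q, of N]
  have "\<bar>expectation_after p \<delta> (N * D) g q\<bar> \<le> 2 * \<kappa> ^ N" by simp
  moreover have "expectation_after p \<delta> (N * D) g q
      = expectation_after p \<delta> k f q - expectation_after p \<delta> l f q"
    using k l unfolding g_def expectation_after_diff
    by (simp add: i_def j_def flip: expectation_after_add)
  ultimately show ?thesis by (simp add: \<kappa>_def \<eta>_def)
qed

end

section \<open>Perturbing the letter probabilities\<close>

text \<open>Cauchy's criterion in each residue class modulo \<open>e\<close>.\<close>

lemma Cauchy_in_residues_imp_asymptotically_periodic:
  fixes x :: "nat \<Rightarrow> real"
  assumes e: "0 < e"
    and x: "\<And>\<epsilon>. 0 < \<epsilon> \<Longrightarrow> \<exists>N. \<forall>k\<ge>N. \<forall>l\<ge>N. k mod e = l mod e \<longrightarrow> \<bar>x k - x l\<bar> \<le> \<epsilon>"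
  shows "\<exists>y. (\<lambda>n. x n - y (n mod e)) \<longlonglongrightarrow> 0"
proof -
  have N_le: "N \<le> e * m + r" if "N \<le> m" for N m r
    using that e by (metis add_leE le_add1 le_trans mult_le_mono mult_1 Suc_leI One_nat_def)
  have "convergent (\<lambda>m. x (e * m + r))" for r
    unfolding Cauchy_convergent_iff[symmetric]
  proof (rule metric_CauchyI)
    fix \<epsilon> :: real assume "0 < \<epsilon>"
    then obtain N where "\<forall>k\<ge>N. \<forall>l\<ge>N. k mod e = l mod e \<longrightarrow> \<bar>x k - x l\<bar> \<le> \<epsilon> / 2"
      using x[of "\<epsilon> / 2"] by auto
    then have "\<bar>x (e * m + r) - x (e * m' + r)\<bar> \<le> \<epsilon> / 2" if "m \<ge> N" "m' \<ge> N" for m m'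
      using that N_le by simp
    then have "dist (x (e * m + r)) (x (e * m' + r)) < \<epsilon>" if "m \<ge> N" "m' \<ge> N" for m m'
      using that \<open>0 < \<epsilon>\<close> by (fastforce simp: dist_real_def)
    then show "\<exists>M. \<forall>m\<ge>M. \<forall>n\<ge>M. dist (x (e * m + r)) (x (e * n + r)) < \<epsilon>"
      by blast
  qed
  then obtain y where y: "\<And>r. (\<lambda>m. x (e * m + r)) \<longlonglongrightarrow> y r"
    unfolding convergent_def by metis
  have "(\<lambda>n. x n - y (n mod e)) \<longlonglongrightarrow> 0"
  proof (rule LIMSEQ_I)
    fix \<epsilon> :: real assume "0 < \<epsilon>"
    then obtain N where N: "\<forall>k\<ge>N. \<forall>l\<ge>N. k mod e = l mod e \<longrightarrow> \<bar>x k - x l\<bar> \<le> \<epsilon> / 2"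
      using x[of "\<epsilon> / 2"] by auto
    have "\<bar>x k - y (k mod e)\<bar> \<le> \<epsilon> / 2" if "k \<ge> N" for k
    proof (rule LIMSEQ_le_const2)
      show "(\<lambda>m. \<bar>x k - x (e * m + k mod e)\<bar>) \<longlonglongrightarrow> \<bar>x k - y (k mod e)\<bar>"
        by (intro tendsto_intros y)
      show "\<exists>N. \<forall>m\<ge>N. \<bar>x k - x (e * m + k mod e)\<bar> \<le> \<epsilon> / 2"
        using N that N_le by (intro exI[of _ N]) simp
    qed
    then show "\<exists>N. \<forall>n\<ge>N. norm (x n - y (n mod e) - 0) < \<epsilon>"
      using \<open>0 < \<epsilon>\<close> by (intro exI[of _ N]) fastforce
  qed
  then show ?thesis by blast
qed

text \<open>The sequence at time \<open>n\<close> uses the \<open>n\<close>-th distribution, so continuity in the letter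
  probabilities alone says nothing about it. Uniform mixing allows time \<open>n\<close> to be replaced by
  one of the finitely many times \<open>M, \<dots>, M + e - 1\<close>, for which continuity is enough.\<close>

theorem expectation_after_perturbation:
  fixes p :: "'a::finite \<Rightarrow> real"
  assumes mix: "mixing_automaton Q \<delta> e D"
    and P: "\<And>n. letter_distribution (P n)" and p: "letter_distribution p"
    and pos: "\<And>a. 0 < p a" and lim: "\<And>a. (\<lambda>n. P n a) \<longlonglongrightarrow> p a"
    and f: "\<And>q. q \<in> Q \<Longrightarrow> 0 \<le> f q \<and> f q \<le> 1" and q: "q \<in> Q"
  shows "\<exists>y. (\<lambda>n. expectation_after (P n) \<delta> n f q - y (n mod e)) \<longlonglongrightarrow> 0 \<and>
             (\<lambda>n. expectation_after p \<delta> n f q - y (n mod e)) \<longlonglongrightarrow> 0"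
proof -
  \<comment> \<open>Half of the smallest limit probability leaves room for the approximating distributions.\<close>
  define c where "c = Min (range p) / 2"
  have e: "0 < e" "e dvd D" using mix by (auto simp: mixing_automaton_def)
  have c: "0 < c" and c_less: "c < p a" for a
  proof -
    have Min: "0 < Min (range p)" "Min (range p) \<le> p a" using pos by simp_all
    from Min(1) show "0 < c" by (simp add: c_def)
    from Min show "c < p a" unfolding c_def by linarith
  qed
  have "\<forall>\<^sub>F n in sequentially. \<forall>a. c < P n a"
    using order_tendstoD(1)[OF lim c_less] by (simp add: eventually_all_finite)
  then obtain n0 where n0: "c \<le> P n a" if "n \<ge> n0" for n a
    unfolding eventually_sequentially by (meson less_imp_le)
  define \<kappa> where "\<kappa> = 1 - (c ^ D)\<^sup>2"
  have "c \<le> 1"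
  proof -
    have "p undefined \<le> sum p UNIV"
      using letter_distribution.nonneg[OF p] by (intro member_le_sum) auto
    then show ?thesis
      using c_less[of undefined] letter_distribution.sum_1[OF p] by simp
  qed
  then have \<kappa>: "0 \<le> \<kappa>" "\<kappa> < 1"
    using c by (auto simp: \<kappa>_def power_le_one)
  have uniform: "\<exists>M. e dvd M \<and> (\<forall>k\<ge>M. \<forall>l\<ge>M. k mod e = l mod e \<longrightarrow>
      (\<forall>n\<ge>n0. \<bar>expectation_after (P n) \<delta> k f q - expectation_after (P n) \<delta> l f q\<bar> \<le> \<epsilon>) \<and>
      \<bar>expectation_after p \<delta> k f q - expectation_after p \<delta> l f q\<bar> \<le> \<epsilon>)"
    if "0 < \<epsilon>" for \<epsilon>
  proof -
    obtain N where "\<kappa> ^ N < \<epsilon> / 2"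
      using real_arch_pow_inv[OF half_gt_zero[OF \<open>0 < \<epsilon>\<close>] \<kappa>(2)] by blast
    then have N: "2 * (1 - (c ^ D)\<^sup>2) ^ N \<le> \<epsilon>" by (simp add: \<kappa>_def)
    show ?thesis
    proof (intro exI[of _ "2 * N * D"] conjI allI impI)
      show "e dvd 2 * N * D" using e by simp
      fix k l assume kl: "2 * N * D \<le> k" "2 * N * D \<le> l" "k mod e = l mod e"
      show "\<bar>expectation_after (P n) \<delta> k f q - expectation_after (P n) \<delta> l f q\<bar> \<le> \<epsilon>"
        if "n0 \<le> n" for n
        using letter_distribution.expectation_after_eventually_periodic
          [OF P mix n0[OF that] less_imp_le[OF c] f q kl] N by (rule order_trans)
      show "\<bar>expectation_after p \<delta> k f q - expectation_after p \<delta> l f q\<bar> \<le> \<epsilon>"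
        using letter_distribution.expectation_after_eventually_periodic
          [OF p mix less_imp_le[OF c_less] less_imp_le[OF c] f q kl] N by (rule order_trans)
    qed
  qed
  obtain y where y: "(\<lambda>n. expectation_after p \<delta> n f q - y (n mod e)) \<longlonglongrightarrow> 0"
    using Cauchy_in_residues_imp_asymptotically_periodic[OF e(1), of "\<lambda>n. expectation_after p \<delta> n f q"]
      uniform by blast
  have "(\<lambda>n. expectation_after (P n) \<delta> n f q - expectation_after p \<delta> n f q) \<longlonglongrightarrow> 0"
  proof (rule LIMSEQ_I)
    fix \<epsilon> :: real assume \<epsilon>: "0 < \<epsilon>"
    define E where "E = (\<lambda>n k. expectation_after (P n) \<delta> k f q)"
    define E' where "E' = (\<lambda>k. expectation_after p \<delta> k f q)"
    obtain M where M: "e dvd M"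
      "\<And>k l n. k \<ge> M \<Longrightarrow> l \<ge> M \<Longrightarrow> k mod e = l mod e \<Longrightarrow> n0 \<le> n \<Longrightarrow> \<bar>E n k - E n l\<bar> \<le> \<epsilon> / 4"
      "\<And>k l. k \<ge> M \<Longrightarrow> l \<ge> M \<Longrightarrow> k mod e = l mod e \<Longrightarrow> \<bar>E' k - E' l\<bar> \<le> \<epsilon> / 4"
      using uniform[of "\<epsilon> / 4"] \<epsilon> unfolding E_def E'_def by (auto 4 4)
    have "\<forall>\<^sub>F n in sequentially. \<bar>E n (M + r) - E' (M + r)\<bar> < \<epsilon> / 4" for r
      using tendstoD[OF expectation_after_tendsto[of P, OF lim], of "\<epsilon> / 4"] \<epsilon>
      by (simp add: E_def E'_def dist_real_def)
    then have "\<forall>\<^sub>F n in sequentially. \<forall>r\<in>{..<e}. \<bar>E n (M + r) - E' (M + r)\<bar> < \<epsilon> / 4"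
      by (simp add: eventually_ball_finite)
    then obtain n1 where n1:
      "\<And>n r. n \<ge> n1 \<Longrightarrow> r < e \<Longrightarrow> \<bar>E n (M + r) - E' (M + r)\<bar> < \<epsilon> / 4"
      unfolding eventually_sequentially by auto
    have "\<bar>E n n - E' n\<bar> < \<epsilon>" if n: "n \<ge> M" "n \<ge> n0" "n \<ge> n1" for n
    proof -
      define l where "l = M + n mod e"
      have l: "l \<ge> M" "n mod e = l mod e"
        using M(1) by (auto simp: l_def mod_add_eq elim!: dvdE)
      have "\<bar>E n n - E n l\<bar> \<le> \<epsilon> / 4" "\<bar>E' n - E' l\<bar> \<le> \<epsilon> / 4"
        using M(2,3) n l by blast+
      moreover have "\<bar>E n l - E' l\<bar> < \<epsilon> / 4"
        unfolding l_def using n e by (intro n1) auto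
      ultimately show ?thesis using \<epsilon> by linarith
    qed
    then show "\<exists>N. \<forall>n\<ge>N. norm (expectation_after (P n) \<delta> n f q
        - expectation_after p \<delta> n f q - 0) < \<epsilon>"
      by (intro exI[of _ "max M (max n0 n1)"]) (auto simp: E_def E'_def)
  qed
  from tendsto_add[OF this y] y show ?thesis by auto
qed

section \<open>Every finite automaton mixes along some period\<close>

definition states_after :: "('q \<Rightarrow> 'a \<Rightarrow> 'q) \<Rightarrow> nat \<Rightarrow> 'q \<Rightarrow> 'q set" where
  "states_after \<delta> k q = foldl \<delta> q ` words k"

lemma states_after_add: "states_after \<delta> (j + k) q = (\<Union>r\<in>states_after \<delta> j q. states_after \<delta> k r)"
proof
  show "states_after \<delta> (j + k) q \<subseteq> (\<Union>r\<in>states_after \<delta> j q. states_after \<delta> k r)"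
    unfolding states_after_def by (auto elim!: words_addE)
  show "(\<Union>r\<in>states_after \<delta> j q. states_after \<delta> k r) \<subseteq> states_after \<delta> (j + k) q"
    unfolding states_after_def by (force intro!: image_eqI[OF _ append_in_words])
qed

lemma closed_under_words_iff_states_after:
  "closed_under_words \<delta> k C \<longleftrightarrow> (\<forall>s\<in>C. states_after \<delta> k s \<subseteq> C)"
  by (auto simp: closed_under_words_def states_after_def)

text \<open>The relations "reachable by a word of length \<open>k\<close>" are the powers of one relation on a
  finite set, and some power of an element of a finite semigroup is idempotent.\<close>

lemma idempotent_states_after:
  fixes \<delta> :: "'q \<Rightarrow> 'a \<Rightarrow> 'q"
  assumes fin: "finite Q" and cl: "closed_under_words \<delta> 1 Q"
  shows "\<exists>D>0. \<forall>q\<in>Q. states_after \<delta> (D + D) q = states_after \<delta> D q"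
proof -
  define F where "F = (\<lambda>k. SIGMA q:Q. states_after \<delta> k q)"
  have "F k \<subseteq> Q \<times> Q" for k
    using closed_under_words_multiple[OF cl, of k]
    by (auto simp: F_def closed_under_words_iff_states_after)
  then have "finite (range F)"
    using fin by (intro finite_subset[of "range F" "Pow (Q \<times> Q)"]) auto
  then have "\<not> inj F" using range_inj_infinite by blast
  then obtain i j where "F i = F j" "i < j"
    unfolding inj_def by (metis linorder_neqE_nat)
  moreover define l where "l = j - i"
  ultimately have l: "0 < l" "F i = F (i + l)" by auto
  have il: "states_after \<delta> i q = states_after \<delta> (i + l) q" if "q \<in> Q" for q
    using arg_cong[OF l(2), of "\<lambda>R. R `` {q}"] that by (simp add: F_def Sigma_Image)
  have step: "states_after \<delta> (k + l) q = states_after \<delta> k q" if "q \<in> Q" "i \<le> k" for q k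
    using il[OF that(1)] states_after_add[of \<delta> i "k - i" q] states_after_add[of \<delta> "i + l" "k - i" q]
      that(2) by (simp add: add.commute add.left_commute)
  have periodic: "states_after \<delta> (k + m * l) q = states_after \<delta> k q" if "q \<in> Q" "i \<le> k" for q k m
  proof (induction m)
    case (Suc m)
    then show ?case
      using step[OF that(1), of "k + m * l"] that(2) by (simp add: ac_simps)
  qed simp
  \<comment> \<open>A multiple of the period \<open>l\<close> beyond the preperiod \<open>i\<close> is an idempotent exponent; the
      factor is \<open>i + 1\<close> rather than \<open>i\<close> to keep it positive.\<close>
  have "i \<le> (i + 1) * l" "0 < (i + 1) * l" using l(1) by (cases l; simp)+
  then show ?thesis using periodic by blast
qed

text \<open>Idempotency makes reachability in \<open>D\<close> steps transitive. A reachable set of least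
  cardinality is then reachable from each of its own members, and so is a recurrent class.\<close>

lemma recurrent_class:
  fixes \<delta> :: "'q \<Rightarrow> 'a \<Rightarrow> 'q"
  assumes fin: "finite Q" and cl: "closed_under_words \<delta> 1 Q"
    and D: "\<And>q. q \<in> Q \<Longrightarrow> states_after \<delta> (D + D) q = states_after \<delta> D q" and q: "q \<in> Q"
  obtains C where "C \<noteq> {}" "C \<subseteq> states_after \<delta> D q" "\<And>s. s \<in> C \<Longrightarrow> states_after \<delta> D s = C"
proof -
  let ?S = "states_after \<delta> D"
  have SQ: "?S r \<subseteq> Q" if "r \<in> Q" for r
    using closed_under_words_multiple[OF cl, of D] that
    by (auto simp: closed_under_words_iff_states_after)
  have trans: "?S s \<subseteq> ?S r" if "r \<in> Q" "s \<in> ?S r" for r s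
    using D[OF that(1)] that(2) by (auto simp: states_after_add)
  have ne: "?S r \<noteq> {}" for r
    using Ex_list_of_length[of D] by (auto simp: states_after_def words_def)
  obtain r where r: "r \<in> ?S q" and least: "\<And>s. s \<in> ?S q \<Longrightarrow> card (?S r) \<le> card (?S s)"
    using arg_min_nat_lemma[of "\<lambda>s. s \<in> ?S q" _ "\<lambda>s. card (?S s)"] ne[of q] by blast
  have rQ: "r \<in> Q" using r SQ q by blast
  have "?S s = ?S r" if "s \<in> ?S r" for s
  proof (rule card_seteq)
    show "finite (?S r)" using SQ[OF rQ] fin by (rule finite_subset)
    show "?S s \<subseteq> ?S r" using trans rQ that .
    show "card (?S r) \<le> card (?S s)" using trans[OF q r] that by (intro least) auto
  qed
  then show ?thesis
    using that[of "?S r"] ne trans[OF q r] by blast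
qed

text \<open>Any state of a recurrent class can serve as its synchronizing state, so that only the
  period \<open>e\<close> under which the recurrent classes are closed remains to be determined.\<close>

lemma mixing_automatonI_recurrent:
  fixes \<delta> :: "'q \<Rightarrow> 'a \<Rightarrow> 'q"
  assumes fin: "finite Q" and cl: "closed_under_words \<delta> 1 Q"
    and D: "\<And>q. q \<in> Q \<Longrightarrow> states_after \<delta> (D + D) q = states_after \<delta> D q"
    and e: "0 < e" "e dvd D"
    and closed: "\<And>C. C \<subseteq> Q \<Longrightarrow> C \<noteq> {} \<Longrightarrow> (\<And>s. s \<in> C \<Longrightarrow> states_after \<delta> D s = C)
      \<Longrightarrow> closed_under_words \<delta> e C"
  shows "mixing_automaton Q \<delta> e D"
  unfolding mixing_automaton_def
proof (intro conjI ballI e cl)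
  fix q assume q: "q \<in> Q"
  obtain C where C: "C \<noteq> {}" "C \<subseteq> states_after \<delta> D q" "\<And>s. s \<in> C \<Longrightarrow> states_after \<delta> D s = C"
    using recurrent_class[OF fin cl D q] by blast
  have "C \<subseteq> Q"
    using closed_under_words_multiple[OF cl, of D] q C(2)
    by (auto simp: closed_under_words_iff_states_after)
  moreover obtain t where "t \<in> C" using C(1) by blast
  then have "\<exists>v\<in>words D. foldl \<delta> s v = t" if "s \<in> C" for s
    using C(3)[OF that] by (auto simp: states_after_def)
  then have "synchronizing_class \<delta> e D C"
    using closed[OF \<open>C \<subseteq> Q\<close> C(1) C(3)] by (auto simp: synchronizing_class_def)
  moreover have "\<exists>w\<in>words D. foldl \<delta> q w \<in> C"
    using C(2) \<open>t \<in> C\<close> by (auto simp: states_after_def)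
  ultimately show "\<exists>C\<subseteq>Q. synchronizing_class \<delta> e D C \<and> (\<exists>w\<in>words D. foldl \<delta> q w \<in> C)"
    by blast
qed

theorem finite_automaton_mixing:
  assumes "finite Q" and "closed_under_words \<delta> 1 Q"
  shows "\<exists>D. mixing_automaton Q \<delta> D D"
proof -
  obtain D where D: "D > 0" "\<And>q. q \<in> Q \<Longrightarrow> states_after \<delta> (D + D) q = states_after \<delta> D q"
    using idempotent_states_after[OF assms] by blast
  have "mixing_automaton Q \<delta> D D"
    by (rule mixing_automatonI_recurrent[OF assms D(2) D(1)])
      (auto simp: closed_under_words_iff_states_after)
  then show ?thesis ..
qed

text \<open>A recurrent class contains a state \<open>s\<close> fixed by \<open>a\<close>. From \<open>s\<close> one may read \<open>a\<close>
  first and so lose any number of steps. Hence what \<open>s\<close> reaches in \<open>D + 1\<close> steps is reached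
  also in \<open>2 D\<close> steps and lies in the class, although \<open>D + 1\<close> is no multiple of \<open>D\<close>.\<close>

theorem aperiodic_automaton_mixing:
  fixes \<delta> :: "'q \<Rightarrow> 'a \<Rightarrow> 'q"
  assumes fin: "finite Q" and cl: "closed_under_words \<delta> 1 Q"
    and aper: "\<And>q. q \<in> Q \<Longrightarrow> foldl \<delta> q (replicate (Suc n) a) = foldl \<delta> q (replicate n a)"
  shows "\<exists>D. mixing_automaton Q \<delta> 1 D"
proof -
  obtain D where D: "D > 0" "\<And>q. q \<in> Q \<Longrightarrow> states_after \<delta> (D + D) q = states_after \<delta> D q"
    using idempotent_states_after[OF fin cl] by blast
  have "mixing_automaton Q \<delta> 1 D"
  proof (rule mixing_automatonI_recurrent[OF fin cl D(2)])
    fix C assume C: "C \<subseteq> Q" "C \<noteq> {}" and rec: "\<And>s. s \<in> C \<Longrightarrow> states_after \<delta> D s = C"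
    obtain r where r: "r \<in> C" using C by blast
    define s where "s = foldl \<delta> r (replicate (n * D) a)"
    have "closed_under_words \<delta> (n * D) C"
    proof (rule closed_under_words_multiple)
      show "closed_under_words \<delta> D C" using rec by (simp add: closed_under_words_iff_states_after)
    qed simp
    then have s: "s \<in> C"
      using r by (auto simp: s_def closed_under_words_def words_def)
    have fixed: "\<delta> s a = s"
    proof -
      define r' where "r' = foldl \<delta> r (replicate (n * D - n) a)"
      have "r' \<in> Q"
        using closed_under_words_multiple[OF cl, of "n * D - n"] r C(1)
        by (auto simp: closed_under_words_def words_def r'_def)
      moreover have "s = foldl \<delta> r' (replicate n a)"
      proof -
        have "n * D = (n * D - n) + n" using D(1) by simp
        then have "replicate (n * D) a = replicate (n * D - n) a @ replicate n a"
          by (metis replicate_add)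
        then show ?thesis by (simp add: s_def r'_def)
      qed
      ultimately show ?thesis
        using aper[of r'] replicate_append_same[of n a] by (metis foldl_Cons foldl_Nil foldl_append replicate_Suc)
    qed
    have mono: "states_after \<delta> k s \<subseteq> states_after \<delta> (k + m) s" for k m
    proof -
      have "foldl \<delta> s (replicate m a) = s" using fixed by (induction m) auto
      then have "s \<in> states_after \<delta> m s"
        unfolding states_after_def words_def by (force intro: image_eqI[of _ _ "replicate m a"])
      then show ?thesis
        using states_after_add[of \<delta> m k s] by (auto simp: add.commute)
    qed
    have "states_after \<delta> 1 u \<subseteq> C" if "u \<in> C" for u
    proof -
      have "states_after \<delta> 1 u \<subseteq> states_after \<delta> (D + 1) s"
        using that rec[OF s] unfolding states_after_add by auto
      also have "\<dots> \<subseteq> states_after \<delta> (D + D) s"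
        using mono[of "D + 1" "D - 1"] D(1) by simp
      also have "\<dots> = C" using D(2) rec s C(1) by blast
      finally show ?thesis .
    qed
    then show "closed_under_words \<delta> 1 C" by (auto simp: closed_under_words_iff_states_after)
  qed auto
  then show ?thesis ..
qed

section \<open>Means of asymptotically periodic sequences\<close>

lemma means_tendsto_0:
  fixes x :: "nat \<Rightarrow> real"
  assumes "x \<longlonglongrightarrow> 0"
  shows "(\<lambda>n. (1 / real n) * (\<Sum>i<n. x i)) \<longlonglongrightarrow> 0"
proof (rule LIMSEQ_I)
  fix \<epsilon> :: real assume \<epsilon>: "0 < \<epsilon>"
  obtain N where N: "\<And>i. i \<ge> N \<Longrightarrow> \<bar>x i\<bar> < \<epsilon> / 2"
    using LIMSEQ_D[OF assms, of "\<epsilon> / 2"] \<epsilon> by auto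
  define B where "B = (\<Sum>i<N. \<bar>x i\<bar>)"
  have "(\<lambda>n. B / real n) \<longlonglongrightarrow> 0" by (rule lim_const_over_n)
  then obtain M where M: "\<And>n. n \<ge> M \<Longrightarrow> \<bar>B / real n\<bar> < \<epsilon> / 2"
    using LIMSEQ_D[of _ 0 "\<epsilon> / 2"] \<epsilon> by (metis half_gt_zero_iff diff_zero real_norm_def)
  have "\<bar>(1 / real n) * (\<Sum>i<n. x i)\<bar> < \<epsilon>" if n: "n \<ge> M" "n \<ge> N" "n > 0" for n
  proof -
    have "\<bar>\<Sum>i<n. x i\<bar> \<le> (\<Sum>i<n. \<bar>x i\<bar>)" by (rule sum_abs)
    also have "\<dots> = B + (\<Sum>i\<in>{N..<n}. \<bar>x i\<bar>)"
      using n by (simp add: B_def lessThan_atLeast0 sum.atLeastLessThan_concat)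
    also have "(\<Sum>i\<in>{N..<n}. \<bar>x i\<bar>) \<le> (\<Sum>i\<in>{N..<n}. \<epsilon> / 2)"
      using N by (intro sum_mono) (auto intro: less_imp_le)
    also have "\<dots> \<le> real n * (\<epsilon> / 2)"
      using \<epsilon> by (simp add: field_simps)
    finally have "\<bar>\<Sum>i<n. x i\<bar> / real n \<le> B / real n + \<epsilon> / 2"
      using n by (simp add: field_simps)
    moreover have "B / real n < \<epsilon> / 2" using M[OF n(1)] by linarith
    ultimately have "\<bar>\<Sum>i<n. x i\<bar> / real n < \<epsilon>" by linarith
    then show ?thesis by (simp add: abs_mult)
  qed
  then show "\<exists>N. \<forall>n\<ge>N. norm ((1 / real n) * (\<Sum>i<n. x i) - 0) < \<epsilon>"
    by (intro exI[of _ "max (Suc M) (max (Suc N) 1)"]) auto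
qed

text \<open>The partial sums \<open>S\<close> of the sequence minus its mean over one period are again periodic,
  hence bounded.\<close>

lemma means_of_periodic:
  fixes y :: "nat \<Rightarrow> real"
  assumes e: "0 < e"
  shows "(\<lambda>n. (1 / real n) * (\<Sum>i<n. y (i mod e))) \<longlonglongrightarrow> (\<Sum>r<e. y r) / e"
proof -
  define d where "d = (\<Sum>r<e. y r) / e"
  define S where "S = (\<lambda>n. \<Sum>i<n. y (i mod e) - d)"
  have Se: "S (e + n) = S n" for n
  proof -
    have "S (e + n) = S e + (\<Sum>i<n. y ((e + i) mod e) - d)"
      unfolding S_def lessThan_atLeast0 using sum.atLeastLessThan_concat[of 0 e "e + n" "\<lambda>i. y (i mod e) - d"]
        sum.shift_bounds_nat_ivl[of "\<lambda>i. y (i mod e) - d" 0 e n] by (simp add: add.commute)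
    also have "S e = 0" using e by (simp add: S_def d_def sum_subtractf)
    finally show ?thesis by (simp add: S_def)
  qed
  have "S n = S (n mod e)" for n
  proof -
    have "S (m * e + r) = S r" for m r
      by (induction m) (simp_all add: Se add.assoc)
    from this[of "n div e" "n mod e"] show ?thesis by simp
  qed
  then have "range S \<subseteq> S ` {..<e}" using e by (metis image_eqI image_subsetI lessThan_iff mod_less_divisor)
  then have "finite (range S)" by (rule finite_subset) simp
  then have "Bseq S" by (simp add: Bseq_eq_bounded finite_imp_bounded)
  moreover have "(\<lambda>n. 1 / real n) \<longlonglongrightarrow> 0" by (rule lim_1_over_n)
  ultimately have "(\<lambda>n. (1 / real n) * S n) \<longlonglongrightarrow> 0"
    using bounded_bilinear.Zfun_prod_Bfun[OF bounded_bilinear_mult, of "\<lambda>n. 1 / real n" sequentially S]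
    by (simp add: tendsto_Zfun_iff)
  from tendsto_add[OF this tendsto_const[of d]]
  have "(\<lambda>n. (1 / real n) * S n + d) \<longlonglongrightarrow> d" by simp
  moreover have "\<forall>\<^sub>F n in sequentially. (1 / real n) * S n + d = (1 / real n) * (\<Sum>i<n. y (i mod e))"
    using eventually_gt_at_top[of 0]
    by eventually_elim (simp add: S_def sum_subtractf field_simps)
  ultimately show ?thesis unfolding d_def by (rule Lim_transform_eventually)
qed

lemma means_of_asymptotically_periodic:
  fixes x y :: "nat \<Rightarrow> real"
  assumes "0 < e" "(\<lambda>n. x n - y (n mod e)) \<longlonglongrightarrow> 0"
  shows "(\<lambda>n. (1 / real n) * (\<Sum>i<n. x i)) \<longlonglongrightarrow> (\<Sum>r<e. y r) / e"
  using tendsto_add[OF means_tendsto_0[OF assms(2)] means_of_periodic[OF assms(1), of y]]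
  by (simp add: sum_subtractf algebra_simps)

section \<open>Bernoulli measures\<close>

lemma topspace_full_shift: "topspace full_shift = UNIV"
  by (simp add: full_shift_def)

lemma continuous_map_coordinate:
  fixes g :: "'a \<Rightarrow> real"
  shows "continuous_map full_shift euclideanreal (\<lambda>x. g (x k))"
proof -
  have "continuous_map full_shift (discrete_topology UNIV) (\<lambda>x :: int \<Rightarrow> 'a. x k)"
    unfolding full_shift_def by (rule continuous_map_product_projection) simp
  moreover have "continuous_map (discrete_topology UNIV) euclideanreal g" by simp
  ultimately show ?thesis
    using continuous_map_compose[of full_shift _ "\<lambda>x. x k" euclideanreal g] by (simp add: o_def)
qed

lemma cylinder_letter: "cylinder [a] = {x. x 0 = a}"
  by (auto simp: cylinder_def)

lemma cylinder_letter_sets: "cylinder [a] \<in> sets shift_borel"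
proof -
  have "openin full_shift {x \<in> topspace full_shift. (if x 0 = a then 1 else 0 :: real) \<in> {1/2<..}}"
    by (rule openin_continuous_map_preimage[OF continuous_map_coordinate]) simp
  then have "openin full_shift (cylinder [a])"
    by (simp add: topspace_full_shift cylinder_letter if_distrib[of "\<lambda>x. _ < x"] if_bool_eq_conj cong: if_cong)
  then show ?thesis by (simp add: shift_borel_def)
qed

definition letter_prob :: "(int \<Rightarrow> 'a) measure \<Rightarrow> 'a \<Rightarrow> real" where
  "letter_prob \<nu> a = measure \<nu> (cylinder [a])"

lemma bernoulli_space:
  assumes "bernoulli_measure \<nu>"
  shows "space \<nu> = UNIV"
proof -
  have "sets \<nu> = sets shift_borel" using assms by (simp add: bernoulli_measure_def)
  then show ?thesis using sets_eq_imp_space_eq[of \<nu> shift_borel] by (simp add: shift_borel_def)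
qed

lemma bernoulli_cylinder:
  assumes "bernoulli_measure \<nu>"
  shows "measure \<nu> (cylinder w) = word_weight (letter_prob \<nu>) w"
proof (induction w)
  case Nil
  interpret prob_space \<nu> using assms by (simp add: bernoulli_measure_def)
  have "cylinder [] = space \<nu>" by (simp add: cylinder_def bernoulli_space[OF assms])
  then show ?case by (simp add: prob_space word_weight_def)
next
  case (Cons a w)
  have "measure \<nu> (cylinder ([a] @ w)) = measure \<nu> (cylinder [a]) * measure \<nu> (cylinder w)"
    using assms unfolding bernoulli_measure_def by blast
  then show ?case using Cons.IH by (simp add: word_weight_def letter_prob_def)
qed

lemma letter_distribution_bernoulli:
  fixes \<nu> :: "(int \<Rightarrow> 'a::finite) measure"
  assumes "bernoulli_measure \<nu>"
  shows "letter_distribution (letter_prob \<nu>)"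
proof
  interpret prob_space \<nu> using assms by (simp add: bernoulli_measure_def)
  have sets: "cylinder [a] \<in> sets \<nu>" for a :: 'a
    using assms cylinder_letter_sets by (auto simp: bernoulli_measure_def)
  have "sum (letter_prob \<nu>) UNIV = measure \<nu> (\<Union>a. cylinder [a])"
    unfolding letter_prob_def using sets
    by (intro finite_measure_finite_Union[symmetric]) (auto simp: disjoint_family_on_def cylinder_letter)
  also have "(\<Union>a :: 'a. cylinder [a]) = space \<nu>"
    by (auto simp: cylinder_letter bernoulli_space[OF assms])
  finally show "sum (letter_prob \<nu>) UNIV = 1" by (simp add: prob_space)
qed (simp add: letter_prob_def)

text \<open>Membership in the cylinder of a letter depends on one coordinate, so its indicator is
  continuous and can be used as a test function.\<close>

lemma letter_prob_tendsto:
  fixes \<mu> :: "nat \<Rightarrow> (int \<Rightarrow> 'a) measure"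
  assumes "\<And>n. bernoulli_measure (\<mu> n)" "bernoulli_measure \<nu>" "weak_star_tendsto \<mu> \<nu>"
  shows "(\<lambda>n. letter_prob (\<mu> n) a) \<longlonglongrightarrow> letter_prob \<nu> a"
proof -
  have integral: "(\<integral>x. (if x 0 = a then 1 else 0) \<partial>\<nu>) = letter_prob \<nu> a"
    if "bernoulli_measure \<nu>" for \<nu>
  proof -
    have "(\<integral>x. (if x 0 = a then 1 else 0) \<partial>\<nu>) = (\<integral>x. indicator (cylinder [a]) x \<partial>\<nu>)"
      by (rule Bochner_Integration.integral_cong) (auto simp: cylinder_letter indicator_def)
    also have "\<dots> = measure \<nu> (cylinder [a])"
      using Bochner_Integration.integral_indicator[of \<nu> "cylinder [a]"]
      by (simp add: bernoulli_space[OF that])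
    finally show ?thesis by (simp add: letter_prob_def)
  qed
  show ?thesis
    using assms(3) continuous_map_coordinate[of "\<lambda>b. if b = a then 1 else 0" 0]
    unfolding weak_star_tendsto_def integral[OF assms(1), symmetric] integral[OF assms(2), symmetric]
    by blast
qed

section \<open>Densities of rational languages\<close>

lemma words_measure_automaton:
  fixes \<nu> :: "(int \<Rightarrow> 'a::finite) measure"
  assumes "bernoulli_measure \<nu>" "L = {w. foldl \<delta> i w \<in> T}"
  shows "words_measure \<nu> (L \<inter> words n) = expectation_after (letter_prob \<nu>) \<delta> n (indicator T) i"
proof -
  have "words_measure \<nu> (L \<inter> words n)
      = (\<Sum>w\<in>words n. if w \<in> L then measure \<nu> (cylinder w) else 0)"
    unfolding words_measure_def Int_commute[of L] by (rule sum.inter_restrict) simp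
  also have "\<dots> = expectation_after (letter_prob \<nu>) \<delta> n (indicator T) i"
    unfolding expectation_after_def using assms
    by (intro sum.cong) (auto simp: bernoulli_cylinder indicator_def)
  finally show ?thesis .
qed

lemma mixing_imp_asymptotically_periodic:
  fixes \<mu> :: "nat \<Rightarrow> (int \<Rightarrow> 'a::finite) measure"
  assumes "\<And>n. bernoulli_measure (\<mu> n)" "bernoulli_measure \<nu>" "positive_measure \<nu>"
    and "weak_star_tendsto \<mu> \<nu>"
    and "mixing_automaton Q \<delta> e D" "i \<in> Q" "L = {w. foldl \<delta> i w \<in> T}"
  shows "\<exists>y. (\<lambda>n. words_measure (\<mu> n) (L \<inter> words n) - y (n mod e)) \<longlonglongrightarrow> 0 \<and>
             (\<lambda>n. words_measure \<nu> (L \<inter> words n) - y (n mod e)) \<longlonglongrightarrow> 0"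
  unfolding words_measure_automaton[OF assms(1,7)] words_measure_automaton[OF assms(2,7)]
proof (rule expectation_after_perturbation[OF assms(5)])
  show "0 < letter_prob \<nu> a" for a
    using assms(3) by (simp add: positive_measure_def letter_prob_def)
qed (use assms in \<open>auto intro: letter_distribution_bernoulli letter_prob_tendsto
       simp: indicator_def\<close>)

text \<open>The automaton is the Cayley graph of the monoid, on which a word acts by multiplication
  with its image. In it every letter satisfies the hypothesis of
  \<open>aperiodic_automaton_mixing\<close>, and an arbitrary one is chosen.\<close>

lemma aperiodic_language_automaton:
  fixes L :: "'a list set"
  assumes "aperiodic_language L"
  obtains Q :: "nat set" and \<delta> i T D
  where "mixing_automaton Q \<delta> 1 D" "i \<in> Q" "L = {w. foldl \<delta> i w \<in> T}"
proof -
  from assms obtain M :: "nat monoid" and \<phi> N where M: "monoid M" "finite (carrier M)"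
    "aperiodic_monoid M" "monoid_morphism \<phi> M" "L = \<phi> -` N"
    unfolding aperiodic_language_def by blast
  interpret monoid M by fact
  define \<delta> where "\<delta> = (\<lambda>m a. m \<otimes>\<^bsub>M\<^esub> \<phi> [a])"
  have \<phi>: "\<phi> w \<in> carrier M" "\<phi> (u @ v) = \<phi> u \<otimes>\<^bsub>M\<^esub> \<phi> v" "\<phi> [] = \<one>\<^bsub>M\<^esub>" for u v w
    using M(4) by (auto simp: monoid_morphism_def hom_def word_monoid_def)
  have run: "foldl \<delta> m w = m \<otimes>\<^bsub>M\<^esub> \<phi> w" if "m \<in> carrier M" for m w
  proof (induction w rule: rev_induct)
    case (snoc a w)
    then show ?case using that by (simp add: \<delta>_def \<phi> m_assoc)
  qed (simp add: \<phi> that)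
  obtain n :: nat where n: "\<And>m. m \<in> carrier M \<Longrightarrow> m [^]\<^bsub>M\<^esub> n = m [^]\<^bsub>M\<^esub> (n + 1)"
    using M(3) unfolding aperiodic_monoid_def by blast
  have pow: "\<phi> (replicate k a) = \<phi> [a] [^]\<^bsub>M\<^esub> k" for k a
  proof (induction k)
    case (Suc k)
    have "\<phi> (replicate (Suc k) a) = \<phi> (replicate k a @ [a])"
      by (simp add: replicate_append_same)
    then show ?case using Suc by (simp add: \<phi>(2))
  qed (simp add: \<phi>)
  have "\<exists>D. mixing_automaton (carrier M) \<delta> 1 D"
  proof (rule aperiodic_automaton_mixing[OF M(2), where n = n and a = undefined])
    show "closed_under_words \<delta> 1 (carrier M)"
      by (simp add: closed_under_words_def run \<phi>)
    show "foldl \<delta> q (replicate (Suc n) undefined) = foldl \<delta> q (replicate n undefined)"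
      if "q \<in> carrier M" for q
      using n[OF \<phi>(1)[of "[undefined]"]] that by (simp add: run pow del: replicate.simps)
  qed
  moreover have "L = {w. foldl \<delta> \<one>\<^bsub>M\<^esub> w \<in> N}"
    using M(5) by (auto simp: run \<phi>)
  ultimately show ?thesis using that by blast
qed

theorem theorem4p1:
  fixes \<mu> :: "nat \<Rightarrow> (int \<Rightarrow> 'a::finite) measure"
    and \<mu>_bar :: "(int \<Rightarrow> 'a) measure"
    and L :: "'a list set"
  assumes "\<And>n. bernoulli_measure (\<mu> n)"
    and "bernoulli_measure \<mu>_bar"
    and "positive_measure \<mu>_bar"
    and "weak_star_tendsto \<mu> \<mu>_bar"
    and "rational_language L"
  shows "(\<exists>d. has_sequential_density \<mu> L d \<and> has_density \<mu>_bar L d) \<and>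
         (aperiodic_language L \<longrightarrow>
            (\<exists>d. has_strong_sequential_density \<mu> L d \<and> has_strong_density \<mu>_bar L d))"
proof (intro conjI impI)
  obtain Q :: "nat set" and \<delta> i T where aut: "recognized_by_automaton Q \<delta> i T L"
    using assms(5) unfolding rational_language_def by blast
  then have Q: "finite Q" "closed_under_words \<delta> 1 Q" "i \<in> Q" "L = {w. foldl \<delta> i w \<in> T}"
    by (auto simp: recognized_by_automaton_def closed_under_words_def words_def length_Suc_conv)
  obtain D where mix: "mixing_automaton Q \<delta> D D"
    using finite_automaton_mixing[OF Q(1,2)] ..
  then have "0 < D" by (simp add: mixing_automaton_def)
  obtain y where "(\<lambda>n. words_measure (\<mu> n) (L \<inter> words n) - y (n mod D)) \<longlonglongrightarrow> 0"
    "(\<lambda>n. words_measure \<mu>_bar (L \<inter> words n) - y (n mod D)) \<longlonglongrightarrow> 0"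
    using mixing_imp_asymptotically_periodic[OF assms(1-4) mix Q(3,4)] by blast
  from this[THEN means_of_asymptotically_periodic[OF \<open>0 < D\<close>]]
  show "\<exists>d. has_sequential_density \<mu> L d \<and> has_density \<mu>_bar L d"
    unfolding has_density_def has_sequential_density_def by blast
next
  assume "aperiodic_language L"
  then obtain Q :: "nat set" and \<delta> i T D
    where mix: "mixing_automaton Q \<delta> 1 D" "i \<in> Q" "L = {w. foldl \<delta> i w \<in> T}"
    by (rule aperiodic_language_automaton)
  obtain y where "(\<lambda>n. words_measure (\<mu> n) (L \<inter> words n) - y (n mod 1)) \<longlonglongrightarrow> 0"
    "(\<lambda>n. words_measure \<mu>_bar (L \<inter> words n) - y (n mod 1)) \<longlonglongrightarrow> 0"
    using mixing_imp_asymptotically_periodic[OF assms(1-4) mix] by blast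
  then have "has_strong_sequential_density \<mu> L (y 0) \<and> has_strong_density \<mu>_bar L (y 0)"
    by (simp add: has_strong_density_def has_strong_sequential_density_def LIM_zero_iff)
  then show "\<exists>d. has_strong_sequential_density \<mu> L d \<and> has_strong_density \<mu>_bar L d" ..
qed

end
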